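(* Let $0<q<1$ and $\nu>-1$ be fixed, and let $j_{1\nu}<j_{2\nu}<\cdots$ be the positive zeros of $z\mapsto J_\nu(z;q^2)$. Then $$J_{\nu}^{\prime}(j_{m\nu};q^{2}):=\left.\frac{\partial J_{\nu}(z;q^2)}{\partial z}\right|_{z=j_{m\nu}}=O\left(q^{-m(m+\nu-2)}\right)\qquad\text{as } m\to\infty .$$
   Context: For $0<p<1$: $(a;p)_0=1$, $(a;p)_n=\prod_{i=0}^{n-1}(1-ap^i)$, $(a;p)_\infty=\lim_{n\to\infty}(a;p)_n$. The third Jackson (Hahn--Exton) $q$-Bessel function, with base $q^2$, is defined for $z>0$ by $$J_{\nu}(z;q^2)=z^{\nu}\frac{(q^{2(\nu+1)};q^2)_\infty}{(q^2;q^2)_\infty}\sum_{k=0}^{\infty}(-1)^k\frac{q^{k(k+1)}}{(q^{2(\nu+1)};q^2)_k\,(q^2;q^2)_k}z^{2k}.$$ It is known that for $\nu>-1$ its positive zeros form a countably infinite set of simple zeros, which can be listed in increasing order $j_{1\nu}<j_{2\nu}<\cdots$. *)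

theory Defs
  imports "HOL-Analysis.Analysis" "HOL-Library.Landau_Symbols"
begin

definition qpoch :: "real \<Rightarrow> real \<Rightarrow> nat \<Rightarrow> real"
  where "qpoch a p n = (\<Prod>i<n. 1 - a * p ^ i)"

definition qpoch_inf :: "real \<Rightarrow> real \<Rightarrow> real"
  where "qpoch_inf a p = lim (\<lambda>n. qpoch a p n)"

(* J_nu(z; q^2), meant for z > 0: the base is q^2, the argument of the constant is q itself. *)
definition hahn_exton_J :: "real \<Rightarrow> real \<Rightarrow> real \<Rightarrow> real"
  where "hahn_exton_J \<nu> q z =
    z powr \<nu> * (qpoch_inf (q powr (2 * (\<nu> + 1))) (q\<^sup>2) / qpoch_inf (q\<^sup>2) (q\<^sup>2)) *
    (\<Sum>k. (-1) ^ k * (q ^ (k * (k + 1)) /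
        (qpoch (q powr (2 * (\<nu> + 1))) (q\<^sup>2) k * qpoch (q\<^sup>2) (q\<^sup>2) k)) * z ^ (2 * k))"

end

theory Submission
  imports Defs
begin

text \<open>
  Write \<open>p = q\<^sup>2\<close>, \<open>a = q powr (2 * (\<nu> + 1))\<close>, and let \<open>F\<^sub>a\<close> be the power series in \<open>w = z\<^sup>2\<close> of
  the Hahn-Exton function, so that \<open>J z = C * z powr \<nu> * F\<^sub>a (z\<^sup>2)\<close> with a positive constant \<open>C\<close>.
  The proof has two parts: the \<open>m\<close>-th positive zero of \<open>J\<close> is at most \<open>1 / q ^ m\<close>, and at such a zero
  the derivative has the asserted size.

  The location of the zeros needs an exact count, not only an asymptotic one: a shift of the index
  by one would change the order of growth. The count is obtained by raising the order \<open>\<nu>\<close> in steps of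
  one, that is, by replacing \<open>a\<close> by \<open>a * p\<close>. The Casorati determinant
  \<open>D w = p * F\<^sub>a w * F\<^sub>a' (p * w) - F\<^sub>a' w * F\<^sub>a (p * w)\<close> satisfies
  \<open>D w = p * (F\<^sub>a (p * w))\<^sup>2 + a * D (p * w)\<close> and is therefore positive (\<open>he_casorati_pos\<close>). By a
  contiguous relation the Wronskian of \<open>F\<^sub>a\<close> and \<open>F\<^sub>a\<^sub>p\<close> is a positive multiple of such a determinant
  (\<open>he_wronskian_pos\<close>), and a positive Wronskian forces a zero of \<open>F\<^sub>a\<close> before the first and between
  any two positive zeros of \<open>F\<^sub>a\<^sub>p\<close>. So \<open>F\<^sub>a\<close> has in \<open>(0, W]\<close> at least as many zeros as the function
  of any order \<open>\<nu> + r\<close> with a natural number \<open>r\<close>. As \<open>r\<close> grows, these functions tend to Euler's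
  product \<open>\<Prod>i. (1 - w * p ^ Suc i)\<close>, whose zeros are \<open>1 / p ^ i\<close>. Hence \<open>F\<^sub>a\<close> has at least \<open>m\<close>
  zeros in \<open>(0, t / p ^ m]\<close> for every \<open>t > 1\<close> close to \<open>1\<close> (\<open>he_fun_has_zeros\<close>), and this gives
  \<open>j m \<le> 1 / q ^ m\<close>.

  For the size of the derivative let \<open>c k\<close> be the coefficients of \<open>F\<^sub>a\<close>. At a zero \<open>z\<close> one has
  \<open>z\<^sup>2 * F\<^sub>a' (z\<^sup>2) = (\<Sum>k. (k - m) * c k * z ^ (2 * k))\<close>, as subtracting \<open>m * F\<^sub>a (z\<^sup>2)\<close> changes
  nothing. Up to bounded factors \<open>\<bar>c k\<bar>\<close> is \<open>q ^ (k * (k + 1))\<close>, and for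
  \<open>z = 1 / q ^ m\<close> the terms are concentrated around \<open>k = m\<close>, where the weight \<open>k - m\<close> is small; a
  smaller \<open>z\<close> makes all terms with \<open>k \<ge> 1\<close> smaller, even with the factor \<open>z powr (\<nu> - 1)\<close>. The
  sum is then dominated by a convergent series that does not depend on \<open>m\<close>, times the asserted
  order (\<open>he_deriv_bound\<close>).
\<close>

section \<open>Counting zeros on the real line\<close>

text \<open>
  A positive Wronskian makes \<open>g / f\<close> strictly increasing wherever \<open>f\<close> does not vanish.
  The quotient would have to fall from a nonnegative value at \<open>x\<close> to \<open>0\<close> at \<open>y\<close>, so \<open>f\<close>
  must vanish in between. The sign condition at \<open>x\<close> covers two situations that arise
  below: \<open>x\<close> is a zero of \<open>g\<close>, or \<open>x\<close> is the origin, where both power series equal \<open>1\<close>.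
\<close>
lemma wronskian_pos_imp_zero_between:
  fixes f g f' g' :: "real \<Rightarrow> real"
  assumes f: "\<And>w. (f has_real_derivative f' w) (at w)"
    and g: "\<And>w. (g has_real_derivative g' w) (at w)"
    and W: "\<And>w. 0 < f w * g' w - f' w * g w"
    and "x < y" "g y = 0" "0 \<le> g x * f x" "f x \<noteq> 0"
  shows "\<exists>z. x < z \<and> z < y \<and> f z = 0"
proof (rule ccontr)
  assume no: "\<not> ?thesis"
  have "f y \<noteq> 0" using W[of y] \<open>g y = 0\<close> by auto
  then have nz: "f z \<noteq> 0" if "x \<le> z" "z \<le> y" for z
    using that no \<open>f x \<noteq> 0\<close> by (cases "z = x \<or> z = y") auto
  have "g x / f x < g y / f y"
  proof (rule DERIV_pos_imp_increasing[OF \<open>x < y\<close>])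
    fix z assume z: "x \<le> z" "z \<le> y"
    have "((\<lambda>w. g w / f w) has_real_derivative (g' z * f z - g z * f' z) / (f z * f z)) (at z)"
      using nz[OF z] by (intro DERIV_divide f g)
    moreover have "(g' z * f z - g z * f' z) / (f z * f z) > 0"
      using W[of z] nz[OF z] by (intro divide_pos_pos) (auto simp: mult_ac zero_less_mult_iff linorder_neq_iff)
    ultimately show "\<exists>D. ((\<lambda>w. g w / f w) has_real_derivative D) (at z) \<and> 0 < D" by blast
  qed
  moreover have "0 \<le> g x / f x"
    using \<open>0 \<le> g x * f x\<close> by (simp add: zero_le_divide_iff zero_le_mult_iff)
  ultimately show False using \<open>g y = 0\<close> by simp
qed

text \<open>
  At least \<open>m\<close> zeros of \<open>f\<close> in \<open>(0, W]\<close>, listed increasingly as \<open>x 1, \<dots>, x m\<close>; the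
  additional node \<open>x 0 = 0\<close> lets the gap before the first zero be treated like the gaps between
  zeros.
\<close>
definition has_zeros :: "(real \<Rightarrow> real) \<Rightarrow> nat \<Rightarrow> real \<Rightarrow> bool"
  where "has_zeros f m W \<longleftrightarrow>
    (\<exists>x. x 0 = 0 \<and> (\<forall>i<m. x i < x (Suc i) \<and> f (x (Suc i)) = 0) \<and> x m \<le> W)"

lemma has_zeros_interleave:
  assumes "0 \<le> l 0" "l m \<le> W"
    and ex: "\<And>i. i < m \<Longrightarrow> \<exists>z. l i < z \<and> z < l (Suc i) \<and> f z = 0"
  shows "has_zeros f m W"
proof -
  obtain z where z: "\<And>i. i < m \<Longrightarrow> l i < z i \<and> z i < l (Suc i) \<and> f (z i) = 0"
    using ex by metis
  define x where "x = (\<lambda>i. case i of 0 \<Rightarrow> 0 | Suc k \<Rightarrow> z k)"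
  have le: "x i \<le> l i" if "i \<le> m" for i
    using that z[of "i - 1"] \<open>0 \<le> l 0\<close> by (cases i) (auto simp: x_def)
  show ?thesis unfolding has_zeros_def
  proof (intro exI[of _ x] conjI allI impI)
    show "x 0 = 0" by (simp add: x_def)
    show "x m \<le> W" using le[of m] \<open>l m \<le> W\<close> by simp
    fix i assume "i < m"
    then show "x i < x (Suc i)" "f (x (Suc i)) = 0"
      using le[of i] z[of i] by (auto simp: x_def split: nat.splits)
  qed
qed

text \<open>The passage from a list of zeros to a count that is independent of any enumeration.\<close>
lemma has_zeros_card:
  assumes "has_zeros f m W"
  shows "\<exists>A. finite A \<and> card A = m \<and> A \<subseteq> {w. 0 < w \<and> w \<le> W \<and> f w = 0}"
proof -
  obtain x where x: "x 0 = 0" "\<And>i. i < m \<Longrightarrow> x i < x (Suc i)"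
    "\<And>i. i < m \<Longrightarrow> f (x (Suc i)) = 0" "x m \<le> W"
    using assms by (auto simp: has_zeros_def)
  have mono: "x i < x k" if "i < k" "k \<le> m" for i k
    using that by (induction k) (use x(2) in \<open>auto simp: less_Suc_eq intro: less_trans\<close>)
  have "inj_on x {1..m}"
    by (rule linorder_inj_onI) (use mono in \<open>force+\<close>)
  then have "card (x ` {1..m}) = m" by (simp add: card_image)
  moreover have "x ` {1..m} \<subseteq> {w. 0 < w \<and> w \<le> W \<and> f w = 0}"
  proof safe
    fix k assume k: "k \<in> {1..m}"
    show "0 < x k" using mono[of 0 k] k x(1) by auto
    show "x k \<le> W" using mono[of k m] k x(4) by (cases "k = m") auto
    show "f (x k) = 0" using x(3)[of "k - 1"] k by auto
  qed
  ultimately show ?thesis by blast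
qed

section \<open>Series estimates\<close>

text \<open>
  A two-sided series centred at \<open>m\<close> and cut off on the left is bounded independently of \<open>m\<close>;
  the argument \<open>(k - m) + (m - k)\<close> is the distance of \<open>k\<close> and \<open>m\<close> in truncated subtraction.
\<close>
lemma suminf_dist_le:
  fixes f :: "nat \<Rightarrow> real"
  assumes nn: "\<And>n. 0 \<le> f n" and f: "summable f"
  shows "summable (\<lambda>k. f ((k - m) + (m - k)))" "(\<Sum>k. f ((k - m) + (m - k))) \<le> 2 * suminf f"
proof -
  let ?g = "\<lambda>k. f ((k - m) + (m - k))"
  show g: "summable ?g"
    using f summable_iff_shift[of ?g m] by simp
  have "sum ?g {..<m} = (\<Sum>i<m. f (Suc (m - Suc i)))"
    by (intro sum.cong) (auto simp: Suc_diff_Suc)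
  also have "\<dots> = (\<Sum>i<m. f (Suc i))"
    by (rule sum.nat_diff_reindex)
  also have "\<dots> = sum f (Suc ` {..<m})"
    by (simp add: sum.reindex)
  also have "\<dots> \<le> suminf f"
    using f nn by (intro sum_le_suminf) auto
  finally have "sum ?g {..<m} \<le> suminf f" .
  moreover have "(\<Sum>k. ?g (k + m)) = suminf f" by simp
  ultimately show "suminf ?g \<le> 2 * suminf f"
    using suminf_split_initial_segment[OF g, of m] by linarith
qed

lemma summable_linear_geometric:
  fixes q :: real
  assumes "0 \<le> q" "q < 1"
  shows "summable (\<lambda>n. real n * q ^ n)"
proof (rule summable_comparison_test')
  show "summable (\<lambda>n. real (Suc n) * q ^ n)"
    using geometric_deriv_sums[of q] assms by (auto simp: sums_iff)
  show "norm (real n * q ^ n) \<le> real (Suc n) * q ^ n" if "n \<ge> 0" for n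
    using assms by (simp add: mult_right_mono)
qed

section \<open>The power series of the Hahn-Exton function\<close>

definition he_coeff :: "real \<Rightarrow> real \<Rightarrow> nat \<Rightarrow> real"
  where "he_coeff q a k = (-1) ^ k * (q ^ (k * (k + 1)) / (qpoch a (q\<^sup>2) k * qpoch (q\<^sup>2) (q\<^sup>2) k))"

text \<open>
  The entire function that remains of the Hahn-Exton function in the variable \<open>w = z\<^sup>2\<close> after its
  elementary prefactor is removed. The order enters through \<open>a = q powr (2 * (\<nu> + 1))\<close> only. The
  value \<open>a = 0\<close>, the limit \<open>\<nu> \<longrightarrow> \<infinity>\<close>, is admitted and gives Euler's series for
  \<open>qpoch_inf (q\<^sup>2 * w) (q\<^sup>2)\<close>.
\<close>
definition he_fun :: "real \<Rightarrow> real \<Rightarrow> real \<Rightarrow> real"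
  where "he_fun q a w = (\<Sum>k. he_coeff q a k * w ^ k)"

text \<open>
  The Casorati determinant, in the index \<open>k\<close> at \<open>k = 0\<close>, of the sequence \<open>he_fun q a ((q\<^sup>2) ^ k * w)\<close>
  and of its derivative with respect to \<open>w\<close>.
\<close>
definition he_casorati :: "real \<Rightarrow> real \<Rightarrow> real \<Rightarrow> real"
  where "he_casorati q a w = q\<^sup>2 * he_fun q a w * deriv (he_fun q a) (q\<^sup>2 * w) -
    deriv (he_fun q a) w * he_fun q a (q\<^sup>2 * w)"

lemma qpoch_0 [simp]: "qpoch a p 0 = 1"
  by (simp add: qpoch_def)

lemma qpoch_Suc: "qpoch a p (Suc n) = qpoch a p n * (1 - a * p ^ n)"
  by (simp add: qpoch_def)

lemma qpoch_Suc_shift: "qpoch a p (Suc n) = (1 - a) * qpoch (a * p) p n"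
  unfolding qpoch_def by (subst prod.lessThan_Suc_shift) (simp add: mult_ac)

context
  fixes q :: real
  assumes q: "0 < q" "q < 1"
begin

lemma q2: "0 < q\<^sup>2" "q\<^sup>2 < 1"
  using q power_strict_mono[of q 1 2] by simp_all

lemma q2_pow: "0 < (q\<^sup>2) ^ k" "(q\<^sup>2) ^ k \<le> 1"
  using q2 by (simp_all add: power_le_one)

lemma qpoch_factor:
  assumes "0 \<le> a" "a < 1"
  shows "0 < 1 - a * (q\<^sup>2) ^ k" "1 - a \<le> 1 - a * (q\<^sup>2) ^ k" "1 - a * (q\<^sup>2) ^ k \<le> 1"
proof -
  have "a * (q\<^sup>2) ^ k \<le> a * 1"
    using assms q2_pow[of k] by (intro mult_left_mono) auto
  moreover have "0 \<le> a * (q\<^sup>2) ^ k"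
    using assms q2_pow[of k] by simp
  ultimately show "0 < 1 - a * (q\<^sup>2) ^ k" "1 - a \<le> 1 - a * (q\<^sup>2) ^ k" "1 - a * (q\<^sup>2) ^ k \<le> 1"
    using assms by auto
qed

lemma qpoch_pos:
  assumes "0 \<le> a" "a < 1"
  shows "0 < qpoch a (q\<^sup>2) k"
  unfolding qpoch_def by (intro prod_pos) (use qpoch_factor[OF assms] in auto)

lemma he_coeff_0: "he_coeff q a 0 = 1"
  by (simp add: he_coeff_def)

lemma he_coeff_Suc:
  assumes "0 \<le> a" "a < 1"
  shows "he_coeff q a (Suc k) * (1 - a * (q\<^sup>2) ^ k) * (1 - (q\<^sup>2) ^ Suc k) = - ((q\<^sup>2) ^ Suc k * he_coeff q a k)"
proof -
  have nz: "qpoch a (q\<^sup>2) k \<noteq> 0" "qpoch (q\<^sup>2) (q\<^sup>2) k \<noteq> 0" "1 - a * (q\<^sup>2) ^ k \<noteq> 0" "1 - q\<^sup>2 * (q\<^sup>2) ^ k \<noteq> 0"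
    using qpoch_pos[OF assms, of k] qpoch_pos[of "q\<^sup>2" k] qpoch_factor(1)[OF assms, of k]
      qpoch_factor(1)[of "q\<^sup>2" k] q2 by auto
  have e: "q ^ (Suc k * (Suc k + 1)) = q ^ (k * (k + 1)) * (q\<^sup>2) ^ Suc k"
    by (simp only: power_mult[symmetric] power_add[symmetric]) (rule arg_cong[of _ _ "power q"], simp add: algebra_simps)
  have gen: "s * (x * P / (A * u * (B * v))) * u * v = s * (P * (x / (A * B)))"
    if "A \<noteq> 0" "B \<noteq> 0" "u \<noteq> 0" "v \<noteq> 0" for s x P A B u v :: real
    using that by simp
  have "he_coeff q a (Suc k) * (1 - a * (q\<^sup>2) ^ k) * (1 - (q\<^sup>2) ^ Suc k)
    = (-1) ^ Suc k * ((q\<^sup>2) ^ Suc k * (q ^ (k * (k + 1)) / (qpoch a (q\<^sup>2) k * qpoch (q\<^sup>2) (q\<^sup>2) k)))"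
    using gen[OF nz, of "(-1) ^ Suc k" "q ^ (k * (k + 1))" "(q\<^sup>2) ^ Suc k"]
    unfolding he_coeff_def e qpoch_Suc power_Suc[of "q\<^sup>2"] .
  then show ?thesis
    unfolding he_coeff_def power_Suc[of "-1"] by (simp only: mult_minus_left mult_1_left mult.left_commute)
qed

lemma summable_he_coeff:
  assumes a: "0 \<le> a" "a < 1"
  shows "summable (\<lambda>k. he_coeff q a k * w ^ k)"
proof -
  define C where "C = \<bar>w\<bar> / ((1 - a) * (1 - q\<^sup>2))"
  have "(\<lambda>k. (q\<^sup>2) ^ Suc k * C) \<longlonglongrightarrow> 0 * C"
    using LIMSEQ_Suc[OF LIMSEQ_power_zero[of "q\<^sup>2"]] q2 by (intro tendsto_mult_right) simp
  then have "eventually (\<lambda>k. (q\<^sup>2) ^ Suc k * C < 1/2) sequentially"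
    by (rule order_tendstoD) auto
  then obtain N where N: "\<And>k. k \<ge> N \<Longrightarrow> (q\<^sup>2) ^ Suc k * C < 1/2"
    by (auto simp: eventually_sequentially)
  show ?thesis
  proof (rule summable_ratio_test[of "1/2" N])
    fix k assume "k \<ge> N"
    let ?D = "(1 - a * (q\<^sup>2) ^ k) * (1 - (q\<^sup>2) ^ Suc k)"
    have D: "(1 - a) * (1 - q\<^sup>2) \<le> ?D"
      using qpoch_factor[OF a, of k] qpoch_factor[of "q\<^sup>2" k] q2 a by (intro mult_mono) auto
    have P: "0 < (1 - a) * (1 - q\<^sup>2)" using a q2 by simp
    have Dp: "0 < ?D" using D P by linarith
    have "he_coeff q a (Suc k) = - ((q\<^sup>2) ^ Suc k * he_coeff q a k) / ?D"
      using he_coeff_Suc[OF a, of k, unfolded mult.assoc] Dp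
      by (subst nonzero_eq_divide_eq) (auto simp only: less_irrefl)
    then have "norm (he_coeff q a (Suc k) * w ^ Suc k) = (q\<^sup>2) ^ Suc k * \<bar>w\<bar> / ?D * norm (he_coeff q a k * w ^ k)"
      using qpoch_factor(1)[OF a, of k] qpoch_factor(1)[of "q\<^sup>2" k] q2
      by (simp add: abs_mult power_abs)
    also have "\<dots> \<le> (q\<^sup>2) ^ Suc k * \<bar>w\<bar> / ((1 - a) * (1 - q\<^sup>2)) * norm (he_coeff q a k * w ^ k)"
      using q2_pow[of "Suc k"]
      by (intro mult_right_mono divide_left_mono[OF D] mult_pos_pos[OF Dp P]) simp_all
    also have "\<dots> = ((q\<^sup>2) ^ Suc k * C) * norm (he_coeff q a k * w ^ k)"
      by (simp add: C_def)
    also have "\<dots> \<le> 1/2 * norm (he_coeff q a k * w ^ k)"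
      using N[OF \<open>k \<ge> N\<close>] by (intro mult_right_mono) auto
    finally show "norm (he_coeff q a (Suc k) * w ^ Suc k) \<le> 1/2 * norm (he_coeff q a k * w ^ k)" .
  qed simp
qed

lemma he_fun_sums:
  assumes "0 \<le> a" "a < 1"
  shows "(\<lambda>k. he_coeff q a k * w ^ k) sums he_fun q a w"
  unfolding he_fun_def using summable_he_coeff[OF assms] by (rule summable_sums)

lemma he_fun_0: "he_fun q a 0 = 1"
  unfolding he_fun_def by (simp add: he_coeff_0)

lemma he_fun_has_deriv_series:
  assumes "0 \<le> a" "a < 1"
  shows "(he_fun q a has_real_derivative (\<Sum>k. diffs (he_coeff q a) k * w ^ k)) (at w)"
  using termdiffs_strong_converges_everywhere[of "he_coeff q a" w] summable_he_coeff[OF assms]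
  unfolding he_fun_def[abs_def] by blast

lemma he_fun_has_deriv:
  assumes "0 \<le> a" "a < 1"
  shows "(he_fun q a has_real_derivative deriv (he_fun q a) w) (at w)"
  using he_fun_has_deriv_series[OF assms] by (metis DERIV_imp_deriv)

lemma isCont_he_fun:
  assumes "0 \<le> a" "a < 1"
  shows "isCont (he_fun q a) w"
  using he_fun_has_deriv[OF assms] DERIV_isCont by blast

lemma isCont_deriv_he_fun:
  assumes "0 \<le> a" "a < 1"
  shows "isCont (deriv (he_fun q a)) w"
proof -
  have "deriv (he_fun q a) = (\<lambda>w. \<Sum>k. diffs (he_coeff q a) k * w ^ k)"
    using he_fun_has_deriv_series[OF assms] by (auto intro!: DERIV_imp_deriv)
  then show ?thesis
    using termdiffs_strong_converges_everywhere[of "diffs (he_coeff q a)" w]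
      termdiff_converges_all[OF summable_he_coeff[OF assms]] DERIV_isCont by metis
qed

text \<open>
  With \<open>p = q\<^sup>2\<close>, the coefficient recursion multiplies out to
  \<open>(1 - p ^ k) * (p - a * p ^ k)\<close> times the \<open>k\<close>-th coefficient, and each power \<open>p ^ k\<close>, \<open>(p ^ k)\<^sup>2\<close>
  is a dilation of \<open>w\<close>. This is the \<open>q\<close>-analogue of Bessel's differential equation.
\<close>
lemma he_fun_qdiff:
  assumes a: "0 \<le> a" "a < 1"
  shows "q\<^sup>2 * he_fun q a w = (q\<^sup>2 + a - q\<^sup>2 * q\<^sup>2 * w) * he_fun q a (q\<^sup>2 * w) - a * he_fun q a (q\<^sup>2 * (q\<^sup>2 * w))"
proof -
  let ?c = "he_coeff q a"
  have "(\<lambda>k. q\<^sup>2 * (?c k * w ^ k) - (q\<^sup>2 + a) * (?c k * (q\<^sup>2 * w) ^ k) + a * (?c k * (q\<^sup>2 * (q\<^sup>2 * w)) ^ k))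
     sums (q\<^sup>2 * he_fun q a w - (q\<^sup>2 + a) * he_fun q a (q\<^sup>2 * w) + a * he_fun q a (q\<^sup>2 * (q\<^sup>2 * w)))" (is "?f sums ?L")
    by (intro sums_add sums_diff sums_mult he_fun_sums a)
  moreover have "?f (Suc k) = - (q\<^sup>2 * q\<^sup>2 * w) * (?c k * (q\<^sup>2 * w) ^ k)" for k
  proof -
    have pow: "(q\<^sup>2 * x) ^ n = (q\<^sup>2) ^ n * x ^ n" for x n
      by (rule power_mult_distrib)
    have "?f (Suc k) = q\<^sup>2 * w ^ Suc k * (?c (Suc k) * (1 - a * (q\<^sup>2) ^ k) * (1 - (q\<^sup>2) ^ Suc k))"
      unfolding pow by (simp add: algebra_simps)
    also have "\<dots> = - (q\<^sup>2 * q\<^sup>2 * w) * (?c k * (q\<^sup>2 * w) ^ k)"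
      unfolding he_coeff_Suc[OF a] by (simp add: power_mult_distrib algebra_simps)
    finally show ?thesis .
  qed
  then have "(\<lambda>k. ?f (Suc k)) sums (- (q\<^sup>2 * q\<^sup>2 * w) * he_fun q a (q\<^sup>2 * w))"
    using sums_mult[OF he_fun_sums[OF a, of "q\<^sup>2 * w"], of "- (q\<^sup>2 * q\<^sup>2 * w)"] by simp
  then have "?f sums (- (q\<^sup>2 * q\<^sup>2 * w) * he_fun q a (q\<^sup>2 * w) + ?f 0)"
    by (rule sums_Suc)
  ultimately have "?L = - (q\<^sup>2 * q\<^sup>2 * w) * he_fun q a (q\<^sup>2 * w) + ?f 0"
    by (rule sums_unique2)
  then show ?thesis by (simp add: algebra_simps)
qed

text \<open>
  Replacing \<open>a\<close> by \<open>a * q\<^sup>2\<close> raises the order \<open>\<nu>\<close> by one. The two coefficients differ by the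
  factor \<open>(1 - a * (q\<^sup>2) ^ k) / (1 - a)\<close>, whose dependence on \<open>k\<close> is again a dilation of \<open>w\<close>.
\<close>
lemma he_fun_contiguous:
  assumes a: "0 \<le> a" "a < 1"
  shows "(1 - a) * he_fun q a w = he_fun q (a * q\<^sup>2) w - a * he_fun q (a * q\<^sup>2) (q\<^sup>2 * w)"
proof -
  let ?b = "a * q\<^sup>2"
  have b: "0 \<le> ?b" "?b < 1"
    using a q2 mult_strict_mono'[of a 1 "q\<^sup>2" 1] by auto
  have *: "(1 - a) * he_coeff q a k = he_coeff q ?b k * (1 - a * (q\<^sup>2) ^ k)" for k
  proof -
    have "qpoch a (q\<^sup>2) k * (1 - a * (q\<^sup>2) ^ k) = (1 - a) * qpoch ?b (q\<^sup>2) k"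
      using qpoch_Suc[of a "q\<^sup>2" k] qpoch_Suc_shift[of a "q\<^sup>2" k] by simp
    moreover have "qpoch a (q\<^sup>2) k > 0" "qpoch ?b (q\<^sup>2) k > 0"
      using qpoch_pos a b by auto
    ultimately have "(1 - a) / qpoch a (q\<^sup>2) k = (1 - a * (q\<^sup>2) ^ k) / qpoch ?b (q\<^sup>2) k"
      by (simp add: divide_simps mult_ac)
    then show ?thesis
      unfolding he_coeff_def by (simp add: divide_inverse mult_ac)
  qed
  have "(\<lambda>k. (1 - a) * (he_coeff q a k * w ^ k)) sums ((1 - a) * he_fun q a w)"
    by (intro sums_mult he_fun_sums a)
  moreover have "(\<lambda>k. he_coeff q ?b k * w ^ k - a * (he_coeff q ?b k * (q\<^sup>2 * w) ^ k))
      sums (he_fun q ?b w - a * he_fun q ?b (q\<^sup>2 * w))"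
    by (intro sums_diff sums_mult he_fun_sums b)
  moreover have "(1 - a) * (he_coeff q a k * w ^ k)
      = he_coeff q ?b k * w ^ k - a * (he_coeff q ?b k * (q\<^sup>2 * w) ^ k)" for k
  proof -
    have "(1 - a) * (he_coeff q a k * w ^ k) = ((1 - a) * he_coeff q a k) * w ^ k"
      by simp
    also have "\<dots> = he_coeff q ?b k * w ^ k - a * (he_coeff q ?b k * (q\<^sup>2 * w) ^ k)"
      unfolding * power_mult_distrib by (simp add: algebra_simps)
    finally show ?thesis .
  qed
  ultimately show ?thesis by (simp add: sums_unique2)
qed

lemma he_fun_dilate_tendsto:
  assumes "0 \<le> a" "a < 1"
  shows "(\<lambda>n. (q\<^sup>2) ^ n * w) \<longlonglongrightarrow> 0" "(\<lambda>n. he_fun q a ((q\<^sup>2) ^ n * w)) \<longlonglongrightarrow> 1"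
proof -
  show lim: "(\<lambda>n. (q\<^sup>2) ^ n * w) \<longlonglongrightarrow> 0"
    using LIMSEQ_power_zero[of "q\<^sup>2"] q2 by (intro tendsto_mult_left_zero) auto
  show "(\<lambda>n. he_fun q a ((q\<^sup>2) ^ n * w)) \<longlonglongrightarrow> 1"
    using isCont_tendsto_compose[OF isCont_he_fun[OF assms] lim] by (simp add: he_fun_0)
qed

section \<open>Interlacing of zeros for consecutive orders\<close>

text \<open>
  The sequence and its \<open>w\<close>-derivative solve the same three-term recurrence, the derivative with an
  inhomogeneity coming from the factor \<open>w\<close> in the \<open>q\<close>-difference equation. In the determinant only
  that inhomogeneity survives, and it contributes a square.
\<close>
lemma he_casorati_rec:
  assumes a: "0 \<le> a" "a < 1"
  shows "he_casorati q a w = q\<^sup>2 * (he_fun q a (q\<^sup>2 * w))\<^sup>2 + a * he_casorati q a (q\<^sup>2 * w)"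
proof -
  let ?F = "he_fun q a" and ?F' = "deriv (he_fun q a)"
  have d [derivative_intros]: "((\<lambda>w. ?F (g w)) has_real_derivative ?F' (g w) * g') (at w)"
    if "(g has_real_derivative g') (at w)" for g g' w
    using DERIV_chain2[OF he_fun_has_deriv[OF a] that] .
  define p where "p = q\<^sup>2"
  have p: "p \<noteq> 0" using q by (simp add: p_def)
  have eq: "p * ?F w = (p + a - p * p * w) * ?F (p * w) - a * ?F (p * (p * w))" for w
    using he_fun_qdiff[OF a] unfolding p_def .
  have "((\<lambda>w. p * ?F w) has_real_derivative p * ?F' w) (at w)"
    by (auto intro!: derivative_eq_intros)
  moreover have "((\<lambda>w. (p + a - p * p * w) * ?F (p * w) - a * ?F (p * (p * w)))
     has_real_derivative (p + a - p * p * w) * (p * ?F' (p * w)) - p * p * ?F (p * w) - a * (p * p * ?F' (p * (p * w)))) (at w)"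
    by (auto intro!: derivative_eq_intros)
  ultimately have eq': "p * ?F' w = (p + a - p * p * w) * (p * ?F' (p * w)) - p * p * ?F (p * w) - a * (p * p * ?F' (p * (p * w)))"
    unfolding eq using DERIV_unique by blast
  have "p * (p * ?F w * ?F' (p * w) - ?F' w * ?F (p * w)) = p * (p * ?F w) * ?F' (p * w) - (p * ?F' w) * ?F (p * w)"
    by (simp add: algebra_simps)
  also have "\<dots> = p * (p * (?F (p * w))\<^sup>2 + a * (p * ?F (p * w) * ?F' (p * (p * w)) - ?F' (p * w) * ?F (p * (p * w))))"
    unfolding eq[of w] eq' by (simp add: algebra_simps power2_eq_square)
  finally show ?thesis
    using p unfolding he_casorati_def p_def[symmetric] by simp
qed

text \<open>
  Iterating the recursion writes the determinant as \<open>\<Sum>k. a ^ k * q\<^sup>2 * (he_fun q a ((q\<^sup>2) ^ Suc k * w))\<^sup>2\<close>,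
  because the remainder carries the factor \<open>a ^ n\<close>. The squares are not all zero since the
  arguments tend to the origin, where the function is \<open>1\<close>.
\<close>
lemma he_casorati_pos:
  assumes a: "0 < a" "a < 1"
  shows "0 < he_casorati q a w"
proof -
  have a0: "0 \<le> a" using a by simp
  let ?F = "he_fun q a"
  note lim = he_fun_dilate_tendsto(1)[OF a0 a(2), of w]
  have it: "he_casorati q a w =
      (\<Sum>k<n. a ^ k * (q\<^sup>2 * (?F ((q\<^sup>2) ^ Suc k * w))\<^sup>2)) + a ^ n * he_casorati q a ((q\<^sup>2) ^ n * w)" for n
  proof (induction n)
    case (Suc n)
    then show ?case
      using he_casorati_rec[OF a0 a(2), of "(q\<^sup>2) ^ n * w"] by (simp add: algebra_simps)
  qed simp
  have "eventually (\<lambda>n. ?F ((q\<^sup>2) ^ n * w) > 0) sequentially"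
    using he_fun_dilate_tendsto(2)[OF a0 a(2)] by (rule order_tendstoD) simp
  then obtain N where N: "?F ((q\<^sup>2) ^ Suc N * w) > 0"
    by (auto simp: eventually_sequentially intro: le_SucI)
  define \<delta> where "\<delta> = a ^ N * (q\<^sup>2 * (?F ((q\<^sup>2) ^ Suc N * w))\<^sup>2)"
  have "\<delta> > 0" unfolding \<delta>_def using N a q2 by (intro mult_pos_pos) auto
  have "isCont (he_casorati q a) 0"
    unfolding he_casorati_def[abs_def]
    by (intro continuous_intros isCont_he_fun[OF a0 a(2)] isCont_deriv_he_fun[OF a0 a(2)]
         isCont_o2[OF _ isCont_he_fun[OF a0 a(2)]] isCont_o2[OF _ isCont_deriv_he_fun[OF a0 a(2)]])
  from isCont_tendsto_compose[OF this lim]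
  have "(\<lambda>n. a ^ n * he_casorati q a ((q\<^sup>2) ^ n * w)) \<longlonglongrightarrow> 0 * he_casorati q a 0"
    using a by (intro tendsto_mult LIMSEQ_power_zero) auto
  then have "(\<lambda>n. \<delta> + a ^ n * he_casorati q a ((q\<^sup>2) ^ n * w)) \<longlonglongrightarrow> \<delta> + 0"
    by (intro tendsto_add tendsto_const) simp
  moreover have "\<forall>n\<ge>Suc N. \<delta> + a ^ n * he_casorati q a ((q\<^sup>2) ^ n * w) \<le> he_casorati q a w"
  proof (intro allI impI)
    fix n assume "n \<ge> Suc N"
    then have "\<delta> \<le> (\<Sum>k<n. a ^ k * (q\<^sup>2 * (?F ((q\<^sup>2) ^ Suc k * w))\<^sup>2))"
      unfolding \<delta>_def using a q2 by (intro member_le_sum[of N "{..<n}" "\<lambda>k. a ^ k * (q\<^sup>2 * (?F ((q\<^sup>2) ^ Suc k * w))\<^sup>2)"]) auto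
    then show "\<delta> + a ^ n * he_casorati q a ((q\<^sup>2) ^ n * w) \<le> he_casorati q a w"
      using it[of n] by linarith
  qed
  ultimately have "\<delta> + 0 \<le> he_casorati q a w"
    by (intro LIMSEQ_le_const2) auto
  then show ?thesis using \<open>\<delta> > 0\<close> by simp
qed

text \<open>
  Inserting the contiguous relation for \<open>he_fun q a\<close> turns the Wronskian of two functions whose
  orders differ by one into \<open>a / (1 - a)\<close> times the Casorati determinant of the second one.
\<close>
lemma he_wronskian_pos:
  assumes a: "0 < a" "a < 1"
  shows "0 < he_fun q a w * deriv (he_fun q (a * q\<^sup>2)) w - deriv (he_fun q a) w * he_fun q (a * q\<^sup>2) w"
proof -
  define p where "p = q\<^sup>2"
  let ?F = "he_fun q a" and ?F' = "deriv (he_fun q a)"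
  let ?G = "he_fun q (a * p)" and ?G' = "deriv (he_fun q (a * p))"
  have b: "0 < a * p" "a * p < 1"
    using a q2 mult_strict_mono'[of a 1 "q\<^sup>2" 1] by (auto simp: p_def)
  have b0: "0 \<le> a * p" using b by simp
  have a0: "0 \<le> a" using a by simp
  have d [derivative_intros]: "((\<lambda>w. ?G (g w)) has_real_derivative ?G' (g w) * g') (at w)"
    if "(g has_real_derivative g') (at w)" for g g' w
    using DERIV_chain2[OF he_fun_has_deriv[OF b0 b(2)] that] .
  have eq: "(1 - a) * ?F w = ?G w - a * ?G (p * w)" for w
    using he_fun_contiguous[OF a0 a(2)] unfolding p_def .
  have "((\<lambda>w. (1 - a) * ?F w) has_real_derivative (1 - a) * ?F' w) (at w)"
    by (intro DERIV_cmult he_fun_has_deriv[OF a0 a(2)])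
  moreover have "((\<lambda>w. ?G w - a * ?G (p * w)) has_real_derivative ?G' w - a * (p * ?G' (p * w))) (at w)"
    by (auto intro!: derivative_eq_intros)
  ultimately have eq': "(1 - a) * ?F' w = ?G' w - a * (p * ?G' (p * w))"
    unfolding eq using DERIV_unique by blast
  have "(1 - a) * (?F w * ?G' w - ?F' w * ?G w) = ((1 - a) * ?F w) * ?G' w - ((1 - a) * ?F' w) * ?G w"
    by (simp add: algebra_simps)
  also have "\<dots> = a * he_casorati q (a * p) w"
    unfolding eq eq' he_casorati_def p_def[symmetric] by (simp add: algebra_simps)
  also have "\<dots> > 0" using a he_casorati_pos[OF b] by simp
  finally show ?thesis using a by (simp add: zero_less_mult_iff p_def)
qed

text \<open>
  The positive zeros of the function of lower order interlace with those of the function of higher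
  order and come first, so no interval \<open>(0, W]\<close> loses zeros when the order is lowered by one.
\<close>
lemma has_zeros_descend:
  assumes a: "0 < a" "a < 1" and z: "has_zeros (he_fun q (a * q\<^sup>2)) m W"
  shows "has_zeros (he_fun q a) m W"
proof -
  let ?b = "a * q\<^sup>2"
  have b: "0 \<le> ?b" "?b < 1"
    using a q2 mult_strict_mono'[of a 1 "q\<^sup>2" 1] by auto
  have a0: "0 \<le> a" using a by simp
  obtain x where x: "x 0 = 0" "\<And>i. i < m \<Longrightarrow> x i < x (Suc i)"
    "\<And>i. i < m \<Longrightarrow> he_fun q ?b (x (Suc i)) = 0" "x m \<le> W"
    using z by (auto simp: has_zeros_def)
  show ?thesis
  proof (rule has_zeros_interleave[of x])
    fix i assume i: "i < m"
    have "0 \<le> he_fun q ?b (x i) * he_fun q a (x i) \<and> he_fun q a (x i) \<noteq> 0"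
    proof (cases i)
      case 0
      then show ?thesis by (simp add: x(1) he_fun_0)
    next
      case (Suc k)
      then have "he_fun q ?b (x i) = 0" using x(3)[of k] i by simp
      then show ?thesis using he_wronskian_pos[OF a, of "x i"] by auto
    qed
    then show "\<exists>z. x i < z \<and> z < x (Suc i) \<and> he_fun q a z = 0"
      using wronskian_pos_imp_zero_between[OF he_fun_has_deriv[OF a0 a(2)]
        he_fun_has_deriv[OF b] he_wronskian_pos[OF a] x(2)[OF i] x(3)[OF i]] by blast
  qed (use x in auto)
qed

lemma has_zeros_descend_power:
  assumes a: "0 < a" "a < 1" and z: "has_zeros (he_fun q (a * (q\<^sup>2) ^ r)) m W"
  shows "has_zeros (he_fun q a) m W"
  using z
proof (induction r)
  case (Suc r)
  have "0 < a * (q\<^sup>2) ^ r" "a * (q\<^sup>2) ^ r < 1"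
    using qpoch_factor(1)[of a r] a q by auto
  from has_zeros_descend[OF this, of m W] Suc show ?case
    by (simp add: mult_ac)
qed simp

section \<open>The limit of large order\<close>

text \<open>
  For \<open>a = 0\<close> the \<open>q\<close>-difference equation drops to first order. Solved by iteration, it gives
  Euler's product, and with it all information on signs and on the infinite products.
\<close>
lemma he_fun_zero_param:
  "he_fun q 0 w = (1 - q\<^sup>2 * w) * he_fun q 0 (q\<^sup>2 * w)"
proof -
  have "q\<^sup>2 * he_fun q 0 w = q\<^sup>2 * ((1 - q\<^sup>2 * w) * he_fun q 0 (q\<^sup>2 * w))"
    using he_fun_qdiff[of 0 w] by (simp add: algebra_simps)
  then show ?thesis using q by simp
qed

lemma qpoch_tendsto:
  "(\<lambda>n. qpoch (q\<^sup>2 * w) (q\<^sup>2) n) \<longlonglongrightarrow> he_fun q 0 w"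
proof -
  have it: "qpoch (q\<^sup>2 * w) (q\<^sup>2) n * he_fun q 0 ((q\<^sup>2) ^ n * w) = he_fun q 0 w" for n
  proof (induction n)
    case (Suc n)
    then show ?case
      using he_fun_zero_param[of "(q\<^sup>2) ^ n * w"] by (simp add: qpoch_Suc mult_ac)
  qed simp
  have F: "(\<lambda>n. he_fun q 0 ((q\<^sup>2) ^ n * w)) \<longlonglongrightarrow> 1"
    by (rule he_fun_dilate_tendsto) simp_all
  then have "(\<lambda>n. he_fun q 0 w / he_fun q 0 ((q\<^sup>2) ^ n * w)) \<longlonglongrightarrow> he_fun q 0 w / 1"
    by (intro tendsto_divide tendsto_const) auto
  moreover have "eventually (\<lambda>n. he_fun q 0 ((q\<^sup>2) ^ n * w) > 0) sequentially"
    using F by (rule order_tendstoD) simp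
  then have "eventually (\<lambda>n. he_fun q 0 w / he_fun q 0 ((q\<^sup>2) ^ n * w) = qpoch (q\<^sup>2 * w) (q\<^sup>2) n) sequentially"
    by eventually_elim (use it in \<open>simp add: nonzero_divide_eq_eq less_imp_neq[THEN not_sym]\<close>)
  ultimately show ?thesis
    by (simp add: tendsto_cong)
qed

lemma he_fun_zero_param_pos:
  assumes "0 \<le> w" "q\<^sup>2 * w < 1"
  shows "0 < he_fun q 0 w"
proof -
  have "(\<lambda>n. he_fun q 0 ((q\<^sup>2) ^ n * w)) \<longlonglongrightarrow> 1"
    by (rule he_fun_dilate_tendsto) simp_all
  then have "eventually (\<lambda>n. he_fun q 0 ((q\<^sup>2) ^ n * w) > 0) sequentially"
    by (rule order_tendstoD) simp
  then obtain n where "he_fun q 0 ((q\<^sup>2) ^ n * w) > 0"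
    by (auto simp: eventually_sequentially)
  then show ?thesis
  proof (induction n)
    case (Suc n)
    have "1 - q\<^sup>2 * w * (q\<^sup>2) ^ n > 0"
      using qpoch_factor(1)[of "q\<^sup>2 * w" n] assms by simp
    then show ?case
      using Suc he_fun_zero_param[of "(q\<^sup>2) ^ n * w"] by (simp add: mult_ac)
  qed simp
qed

lemma qpoch_inf_pos:
  assumes "0 \<le> x" "x < 1"
  shows "0 < qpoch_inf x (q\<^sup>2)"
proof -
  have "qpoch_inf x (q\<^sup>2) = he_fun q 0 (x / q\<^sup>2)"
    using qpoch_tendsto[of "x / q\<^sup>2"] q by (auto simp: qpoch_inf_def intro: limI)
  also have "\<dots> > 0"
    using assms q by (intro he_fun_zero_param_pos) auto
  finally show ?thesis .
qed

lemma qpoch_inf_le: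
  assumes "0 \<le> x" "x < 1"
  shows "qpoch_inf x (q\<^sup>2) \<le> qpoch x (q\<^sup>2) n"
proof (rule decseq_ge)
  show "decseq (qpoch x (q\<^sup>2))"
  proof (rule decseq_SucI)
    fix n
    show "qpoch x (q\<^sup>2) (Suc n) \<le> qpoch x (q\<^sup>2) n"
      using qpoch_pos[OF assms, of n] qpoch_factor[OF assms, of n]
      by (simp add: qpoch_Suc mult_left_le)
  qed
  show "qpoch x (q\<^sup>2) \<longlonglongrightarrow> qpoch_inf x (q\<^sup>2)"
    using qpoch_tendsto[of "x / q\<^sup>2"] q limI[OF qpoch_tendsto[of "x / q\<^sup>2"]]
    by (simp add: qpoch_inf_def)
qed

lemma abs_he_coeff:
  assumes "0 \<le> a" "a < 1"
  shows "\<bar>he_coeff q a k\<bar> = q ^ (k * (k + 1)) / (qpoch a (q\<^sup>2) k * qpoch (q\<^sup>2) (q\<^sup>2) k)"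
  using qpoch_pos[OF assms, of k] qpoch_pos[of "q\<^sup>2" k] q2 q
  unfolding he_coeff_def abs_mult abs_divide by simp

lemma abs_he_coeff_le:
  assumes a: "0 \<le> a" "a < 1"
  shows "\<bar>he_coeff q a k\<bar> \<le> q ^ (k * (k + 1)) / (qpoch_inf a (q\<^sup>2) * qpoch_inf (q\<^sup>2) (q\<^sup>2))"
  unfolding abs_he_coeff[OF a] using q2 q a
    qpoch_inf_pos[of a] qpoch_inf_pos[of "q\<^sup>2"] qpoch_pos[of a k] qpoch_pos[of "q\<^sup>2" k]
  by (intro divide_left_mono mult_mono mult_pos_pos qpoch_inf_le) simp_all

lemma abs_he_coeff_mono:
  assumes "0 \<le> b" "b \<le> a" "a < 1"
  shows "\<bar>he_coeff q b k\<bar> \<le> \<bar>he_coeff q a k\<bar>"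
proof -
  have "1 - a * (q\<^sup>2) ^ i \<le> 1 - b * (q\<^sup>2) ^ i" for i
    using assms q by (simp add: mult_right_mono)
  then have "qpoch a (q\<^sup>2) k \<le> qpoch b (q\<^sup>2) k"
    unfolding qpoch_def using qpoch_factor(1)[of a] assms
    by (intro prod_mono) (auto intro: less_imp_le)
  moreover have "0 < qpoch a (q\<^sup>2) k" "0 < qpoch b (q\<^sup>2) k" "0 < qpoch (q\<^sup>2) (q\<^sup>2) k"
    using assms q2 by (auto intro!: qpoch_pos)
  ultimately show ?thesis
    using assms q by (simp add: abs_he_coeff) (intro divide_left_mono mult_right_mono mult_pos_pos; simp)
qed

text \<open>
  As the order grows, the function tends to Euler's product. The coefficients are dominated by
  those for \<open>a\<close> itself, so Tannery's theorem applies.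
\<close>
lemma he_fun_tendsto_zero_param:
  assumes a: "0 \<le> a" "a < 1"
  shows "(\<lambda>r. he_fun q (a * (q\<^sup>2) ^ r) w) \<longlonglongrightarrow> he_fun q 0 w"
proof -
  have lim0: "(\<lambda>r. a * (q\<^sup>2) ^ r) \<longlonglongrightarrow> 0"
    using LIMSEQ_power_zero[of "q\<^sup>2"] q2 by (intro tendsto_mult_right_zero) auto
  have qlim: "(\<lambda>r. qpoch (a * (q\<^sup>2) ^ r) (q\<^sup>2) k) \<longlonglongrightarrow> qpoch 0 (q\<^sup>2) k" for k
    unfolding qpoch_def by (intro tendsto_prod tendsto_diff tendsto_const tendsto_mult lim0)
  have lim: "(\<lambda>r. he_coeff q (a * (q\<^sup>2) ^ r) k * w ^ k) \<longlonglongrightarrow> he_coeff q 0 k * w ^ k" for k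
    unfolding he_coeff_def using qpoch_pos[of 0 k] qpoch_pos[of "q\<^sup>2" k] q2
    by (intro tendsto_mult tendsto_divide tendsto_const qlim) auto
  have bound: "norm (he_coeff q (a * (q\<^sup>2) ^ r) k * w ^ k) \<le> norm (he_coeff q a k * w ^ k)" for r k
  proof -
    have "a * (q\<^sup>2) ^ r \<le> a" using q2_pow[of r] a by (simp add: mult_left_le)
    then have "\<bar>he_coeff q (a * (q\<^sup>2) ^ r) k\<bar> \<le> \<bar>he_coeff q a k\<bar>"
      using a q by (intro abs_he_coeff_mono) auto
    then show ?thesis by (simp add: abs_mult mult_right_mono)
  qed
  have ev: "eventually (\<lambda>(k, r). norm (he_coeff q (a * (q\<^sup>2) ^ r) k * w ^ k)
      \<le> norm (he_coeff q a k * w ^ k)) (at_top \<times>\<^sub>F sequentially)"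
    using bound by (intro always_eventually) auto
  have "summable (\<lambda>k. norm (he_coeff q a k * w ^ k))"
    using powser_insidea[OF summable_he_coeff[OF a, of "\<bar>w\<bar> + 1"], of w] by simp
  then show ?thesis
    unfolding he_fun_def
    using tannerys_theorem[OF lim ev] by simp
qed

text \<open>
  Euler's product vanishes exactly at \<open>w = 1 / (q\<^sup>2) ^ i\<close> with \<open>i \<ge> 1\<close>, and the points
  \<open>t / (q\<^sup>2) ^ i\<close> separate these zeros.
\<close>
lemma he_fun_zero_param_sign:
  assumes "1 < t" "q\<^sup>2 * t < 1"
  shows "0 < (-1) ^ i * he_fun q 0 (t / (q\<^sup>2) ^ i)"
proof (induction i)
  case 0
  then show ?case using he_fun_zero_param_pos[of t] assms by simp
next
  case (Suc i)
  have "he_fun q 0 (t / (q\<^sup>2) ^ Suc i) = (1 - t / (q\<^sup>2) ^ i) * he_fun q 0 (t / (q\<^sup>2) ^ i)"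
    using he_fun_zero_param[of "t / (q\<^sup>2) ^ Suc i"] q by simp
  then have "(-1) ^ Suc i * he_fun q 0 (t / (q\<^sup>2) ^ Suc i)
      = (t / (q\<^sup>2) ^ i - 1) * ((-1) ^ i * he_fun q 0 (t / (q\<^sup>2) ^ i))"
    by (simp only: power_Suc[of "-1"] left_diff_distrib) (simp add: algebra_simps)
  moreover have "t / (q\<^sup>2) ^ i > 1"
    using assms q2_pow[of i] by (simp add: less_divide_eq)
  ultimately show ?case using Suc by simp
qed

text \<open>
  At the finitely many points \<open>t / (q\<^sup>2) ^ i\<close>, \<open>i \<le> m\<close>, the function of sufficiently high order has
  the alternating signs of Euler's product, hence \<open>m\<close> zeros between them. Lowering the order back
  keeps them in place or moves them to the left.
\<close>
lemma he_fun_has_zeros: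
  assumes a: "0 < a" "a < 1" and t: "1 < t" "q\<^sup>2 * t < 1"
  shows "has_zeros (he_fun q a) m (t / (q\<^sup>2) ^ m)"
proof -
  let ?l = "\<lambda>i. t / (q\<^sup>2) ^ i"
  have "eventually (\<lambda>r. \<forall>i\<in>{..m}. 0 < (-1) ^ i * he_fun q (a * (q\<^sup>2) ^ r) (?l i)) sequentially"
  proof (intro eventually_ball_finite ballI)
    fix i
    have "(\<lambda>r. (-1) ^ i * he_fun q (a * (q\<^sup>2) ^ r) (?l i)) \<longlonglongrightarrow> (-1) ^ i * he_fun q 0 (?l i)"
      using a by (intro tendsto_mult tendsto_const he_fun_tendsto_zero_param) auto
    then show "eventually (\<lambda>r. 0 < (-1) ^ i * he_fun q (a * (q\<^sup>2) ^ r) (?l i)) sequentially"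
      using he_fun_zero_param_sign[OF t] by (rule order_tendstoD)
  qed simp
  then obtain r where r: "\<And>i. i \<le> m \<Longrightarrow> 0 < (-1) ^ i * he_fun q (a * (q\<^sup>2) ^ r) (?l i)"
    by (auto simp: eventually_sequentially)
  define b where "b = a * (q\<^sup>2) ^ r"
  have b: "0 \<le> b" "b < 1"
    using qpoch_factor(1)[of a r] a q by (auto simp: b_def)
  have "has_zeros (he_fun q b) m (?l m)"
  proof (rule has_zeros_interleave[of ?l])
    fix i assume i: "i < m"
    have s: "0 < (-1) ^ i * he_fun q b (?l i)" "0 < (-1) ^ Suc i * he_fun q b (?l (Suc i))"
      using r[of i] r[of "Suc i"] i by (auto simp: b_def)
    have l: "?l i < ?l (Suc i)"
      using t q2 q2_pow[of i] by (intro divide_strict_left_mono) auto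
    have "\<exists>z. ?l i \<le> z \<and> z \<le> ?l (Suc i) \<and> (\<lambda>z. - ((-1) ^ i * he_fun q b z)) z = 0"
      using s l by (intro IVT) (auto intro!: continuous_intros isCont_he_fun[OF b])
    then obtain z where z: "?l i \<le> z" "z \<le> ?l (Suc i)" "he_fun q b z = 0" by auto
    moreover have "z \<noteq> ?l i" "z \<noteq> ?l (Suc i)" using s z(3) by auto
    ultimately show "\<exists>z. ?l i < z \<and> z < ?l (Suc i) \<and> he_fun q b z = 0"
      by (intro exI[of _ z]) (simp add: less_le)
  qed (use t in auto)
  then show ?thesis
    using has_zeros_descend_power[OF a] by (simp add: b_def)
qed

section \<open>The derivative at a zero\<close>

text \<open>
  At a zero of the function the sum is the same for every \<open>s\<close>. Taking for \<open>s\<close> the index around which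
  the terms are largest gives these terms a small weight.
\<close>
lemma he_fun_deriv_sums:
  assumes a: "0 \<le> a" "a < 1"
  shows "(\<lambda>k. (real k - s) * (he_coeff q a k * w ^ k)) sums (w * deriv (he_fun q a) w - s * he_fun q a w)"
proof -
  have "(\<lambda>k. diffs (he_coeff q a) k * w ^ k) sums (deriv (he_fun q a) w)"
    using DERIV_imp_deriv[OF he_fun_has_deriv_series[OF a, of w]]
      termdiff_converges_all[OF summable_he_coeff[OF a], of w] by (simp add: sums_iff)
  from sums_mult[OF this, of w]
  have "(\<lambda>k. real (Suc k) * (he_coeff q a (Suc k) * w ^ Suc k)) sums (w * deriv (he_fun q a) w)"
    by (simp add: diffs_def mult_ac)
  from sums_Suc[OF this]
  have "(\<lambda>k. real k * (he_coeff q a k * w ^ k)) sums (w * deriv (he_fun q a) w)" by simp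
  from sums_diff[OF this sums_mult[OF he_fun_sums[OF a, of w], of s]]
  show ?thesis by (simp add: algebra_simps)
qed

text \<open>
  With \<open>z = t / q ^ m\<close> and \<open>n = k - m\<close>, the term on the left is
  \<open>t powr (\<nu> - 1 + 2 * k) * q powr (n * (n + 1))\<close> times the claimed order of growth. The power of
  \<open>t \<le> 1\<close> is at most \<open>1\<close> except possibly for \<open>k = 0\<close>. There \<open>\<nu> > -1\<close> and the lower bound
  \<open>\<delta>\<close> on \<open>z\<close> leave a loss of at most \<open>q powr (- 2 * m) / \<delta>\<^sup>2\<close>, where \<open>m\<close> is the distance of \<open>k\<close>
  to \<open>m\<close>. Granting this loss \<open>q powr (- 2 * d)\<close> to all \<open>k\<close>, with \<open>d\<close> the distance, costs nothing
  essential, since \<open>n * (n + 1) - 2 * d \<ge> d\<^sup>2 - 3 * d \<ge> d - 4\<close>.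
\<close>
lemma he_term_bound:
  assumes \<nu>: "\<nu> > -1" and z: "0 < \<delta>" "\<delta> \<le> z" "z * q ^ m \<le> 1"
  shows "z powr (\<nu> - 1) * (q ^ (k * (k + 1)) * (z\<^sup>2) ^ k)
    \<le> max 1 (1 / \<delta>\<^sup>2) * q powr (-4) * q powr (- (real m * (real m + \<nu> - 2))) * q ^ ((k - m) + (m - k))"
proof -
  define t where "t = z * q powr real m"
  define d where "d = (k - m) + (m - k)"
  define M where "M = max 1 (1 / \<delta>\<^sup>2)"
  have z0: "0 < z" using z by simp
  have t: "0 < t" "t \<le> 1" using z z0 q by (auto simp: t_def powr_realpow)
  have zt: "z = t * q powr (- real m)"
    using q by (simp add: t_def powr_minus field_simps)
  have dn: "real d = \<bar>real k - real m\<bar>" by (simp add: d_def)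
  have zk: "z powr (2 * real k) = (z\<^sup>2) ^ k"
    using powr_realpow[OF z0, of "2 * k"] by (simp add: power_mult)
  have "z powr (\<nu> - 1) * (q ^ (k * (k + 1)) * (z\<^sup>2) ^ k)
      = z powr (\<nu> - 1 + 2 * real k) * q powr (real (k * (k + 1)))"
    unfolding powr_add zk powr_realpow[OF q(1)] by (simp only: mult_ac)
  also have "\<dots> = t powr (\<nu> - 1 + 2 * real k) * q powr (- real m * (\<nu> - 1 + 2 * real k) + real (k * (k + 1)))"
  proof -
    have "z powr e = t powr e * q powr (- real m * e)" for e
      unfolding zt using t q by (simp add: powr_mult powr_powr)
    from this[of "\<nu> - 1 + 2 * real k"] show ?thesis
      by (simp only: powr_add[of q "- real m * (\<nu> - 1 + 2 * real k)"] mult.assoc)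
  qed
  also have "\<dots> \<le> (M * q powr (- 2 * real d)) * q powr (- real m * (\<nu> - 1 + 2 * real k) + real (k * (k + 1)))"
  proof (rule mult_right_mono)
    show "t powr (\<nu> - 1 + 2 * real k) \<le> M * q powr (- 2 * real d)"
    proof (cases "k = 0")
      case True
      have "t powr (\<nu> - 1 + 2 * real k) \<le> t powr (-2)"
        using t \<nu> True by (intro powr_mono') auto
      also have "\<dots> = (1 / z\<^sup>2) * q powr (- 2 * real d)"
        using z0 q True by (simp add: t_def d_def powr_mult powr_powr powr_minus powr_realpow[of _ 2] divide_simps mult.commute)
      also have "\<dots> \<le> M * q powr (- 2 * real d)"
      proof (rule mult_right_mono)
        have "1 / z\<^sup>2 \<le> 1 / \<delta>\<^sup>2"
          using z by (intro divide_left_mono power_mono) auto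
        then show "1 / z\<^sup>2 \<le> M" by (simp add: M_def)
      qed simp
      finally show ?thesis .
    next
      case False
      then have "t powr (\<nu> - 1 + 2 * real k) \<le> 1"
        using t \<nu> by (intro powr_le1) auto
      moreover have "1 * 1 \<le> M * q powr (- 2 * real d)"
        using q powr_mono'[of "- 2 * real d" 0 q] by (intro mult_mono) (auto simp: M_def)
      ultimately show ?thesis by linarith
    qed
  qed simp
  also have "\<dots> = M * q powr (- 2 * real d + (- real m * (\<nu> - 1 + 2 * real k) + real (k * (k + 1))))"
    by (simp only: powr_add[of q "- 2 * real d"] mult.assoc)
  also have "\<dots> \<le> M * q powr (-4 + (- (real m * (real m + \<nu> - 2)) + real d))"
  proof (rule mult_left_mono)
    have "real d * real d = (real k - real m) * (real k - real m)" unfolding dn by simp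
    moreover have "real k - real m \<ge> - real d" unfolding dn by simp
    (* d^2 - 3 d - (d - 4) is the square of d - 2 *)
    moreover have "(real d - 2) * (real d - 2) \<ge> 0" by simp
    ultimately have "-4 + (- (real m * (real m + \<nu> - 2)) + real d)
        \<le> - 2 * real d + (- real m * (\<nu> - 1 + 2 * real k) + real (k * (k + 1)))"
      by (simp add: algebra_simps)
    then show "q powr (- 2 * real d + (- real m * (\<nu> - 1 + 2 * real k) + real (k * (k + 1))))
      \<le> q powr (-4 + (- (real m * (real m + \<nu> - 2)) + real d))"
      using q by (intro powr_mono') auto
    show "0 \<le> M" by (simp add: M_def)
  qed
  also have "\<dots> = M * q powr (-4) * q powr (- (real m * (real m + \<nu> - 2))) * q ^ d"
    by (simp only: powr_add powr_realpow[OF q(1)] mult.assoc)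
  finally show ?thesis unfolding M_def d_def .
qed

text \<open>
  The termwise estimate, summed over \<open>k\<close> with the weights \<open>\<bar>k - m\<bar>\<close>. Weights \<open>k\<close> in their place
  would cost a factor \<open>m\<close> and miss the asserted order.
\<close>
lemma he_deriv_bound:
  assumes a: "0 \<le> a" "a < 1" and \<nu>: "\<nu> > -1" and z: "0 < \<delta>" "\<delta> \<le> z" "z * q ^ m \<le> 1"
    and zero: "he_fun q a (z\<^sup>2) = 0"
  shows "z powr (\<nu> - 1) * \<bar>z\<^sup>2 * deriv (he_fun q a) (z\<^sup>2)\<bar>
    \<le> 2 * (\<Sum>n. real n * q ^ n) * max 1 (1 / \<delta>\<^sup>2) * q powr (-4)
        / (qpoch_inf a (q\<^sup>2) * qpoch_inf (q\<^sup>2) (q\<^sup>2)) * q powr (- (real m * (real m + \<nu> - 2)))"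
proof -
  define K where "K = qpoch_inf a (q\<^sup>2) * qpoch_inf (q\<^sup>2) (q\<^sup>2)"
  define B where "B = max 1 (1 / \<delta>\<^sup>2) * q powr (-4) * q powr (- (real m * (real m + \<nu> - 2)))"
  have K: "0 < K" using qpoch_inf_pos a q2 by (simp add: K_def)
  have B: "0 \<le> B" by (simp add: B_def)
  define f where "f = (\<lambda>n. real n * q ^ n)"
  have f: "summable f" "\<And>n. 0 \<le> f n"
    using summable_linear_geometric[of q] q by (auto simp: f_def)
  note fd = suminf_dist_le[OF f(2,1), of m]
  have s: "(\<lambda>k. z powr (\<nu> - 1) * ((real k - real m) * (he_coeff q a k * (z\<^sup>2) ^ k)))
      sums (z powr (\<nu> - 1) * (z\<^sup>2 * deriv (he_fun q a) (z\<^sup>2)))"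
    using sums_mult[OF he_fun_deriv_sums[OF a, of "real m" "z\<^sup>2"]] zero by simp
  have b: "norm (z powr (\<nu> - 1) * ((real k - real m) * (he_coeff q a k * (z\<^sup>2) ^ k)))
      \<le> B / K * f ((k - m) + (m - k))" for k
  proof -
    let ?d = "(k - m) + (m - k)"
    have dn: "\<bar>real k - real m\<bar> = real ?d" by simp
    have "norm (z powr (\<nu> - 1) * ((real k - real m) * (he_coeff q a k * (z\<^sup>2) ^ k)))
        = real ?d * (z powr (\<nu> - 1) * (\<bar>he_coeff q a k\<bar> * (z\<^sup>2) ^ k))"
      unfolding real_norm_def abs_mult dn by simp
    also have "\<dots> \<le> real ?d * (z powr (\<nu> - 1) * (q ^ (k * (k + 1)) / K * (z\<^sup>2) ^ k))"
      unfolding K_def by (intro mult_left_mono mult_right_mono abs_he_coeff_le[OF a]) auto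
    also have "\<dots> = real ?d / K * (z powr (\<nu> - 1) * (q ^ (k * (k + 1)) * (z\<^sup>2) ^ k))"
      by simp
    also have "\<dots> \<le> real ?d / K * (B * q ^ ?d)"
      unfolding B_def using K by (intro mult_left_mono he_term_bound \<nu> z) auto
    also have "\<dots> = B / K * f ?d" by (simp add: f_def)
    finally show ?thesis .
  qed
  have "z powr (\<nu> - 1) * \<bar>z\<^sup>2 * deriv (he_fun q a) (z\<^sup>2)\<bar>
      = norm (\<Sum>k. z powr (\<nu> - 1) * ((real k - real m) * (he_coeff q a k * (z\<^sup>2) ^ k)))"
    unfolding sums_unique[OF s, symmetric] by (simp add: abs_mult)
  also have "\<dots> \<le> (\<Sum>k. B / K * f ((k - m) + (m - k)))"
    by (intro norm_suminf_le b summable_mult fd)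
  also have "\<dots> = B / K * (\<Sum>k. f ((k - m) + (m - k)))"
    by (rule suminf_mult[OF fd(1)])
  also have "\<dots> \<le> B / K * (2 * suminf f)"
    using B K by (intro mult_left_mono fd(2)) auto
  finally show ?thesis by (simp add: B_def K_def f_def mult_ac)
qed

end

lemma hahn_exton_J_eq:
  "hahn_exton_J \<nu> q z = z powr \<nu> * (qpoch_inf (q powr (2 * (\<nu> + 1))) (q\<^sup>2) / qpoch_inf (q\<^sup>2) (q\<^sup>2))
     * he_fun q (q powr (2 * (\<nu> + 1))) (z\<^sup>2)"
  unfolding hahn_exton_J_def he_fun_def he_coeff_def power_mult ..

theorem theorem3p5:
  fixes q \<nu> :: real and j :: "nat \<Rightarrow> real"
  assumes "0 < q" and "q < 1" and "\<nu> > -1"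
    and "strict_mono_on {1..} j"
    and "j ` {1..} = {z. z > 0 \<and> hahn_exton_J \<nu> q z = 0}"
  shows "(\<lambda>m. deriv (hahn_exton_J \<nu> q) (j m))
           \<in> O(\<lambda>m. q powr (- (real m * (real m + \<nu> - 2))))"
proof -
  note q = \<open>0 < q\<close> \<open>q < 1\<close>
  define a where "a = q powr (2 * (\<nu> + 1))"
  define C where "C = qpoch_inf a (q\<^sup>2) / qpoch_inf (q\<^sup>2) (q\<^sup>2)"
  have a: "0 < a" "a < 1"
    using assms powr_less_mono'[of q 0 "2 * (\<nu> + 1)"] by (auto simp: a_def)
  have a0: "0 \<le> a" using a by simp
  have C: "0 < C"
    using qpoch_inf_pos[OF q] a q2[OF q] by (simp add: C_def)
  have J: "hahn_exton_J \<nu> q z = z powr \<nu> * C * he_fun q a (z\<^sup>2)" for z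
    by (simp add: hahn_exton_J_eq a_def C_def)
  have zeros: "j ` {1..} = {z. z > 0 \<and> he_fun q a (z\<^sup>2) = 0}"
    unfolding assms(5) using C by (auto simp: J)
  have jm: "0 < j m" "he_fun q a ((j m)\<^sup>2) = 0" if "1 \<le> m" for m
    using zeros that by auto
  have upper: "j m * q ^ m \<le> 1" if m: "1 \<le> m" for m
  proof (rule ccontr)
    assume "\<not> j m * q ^ m \<le> 1"
    then have "1 < (j m * q ^ m)\<^sup>2" by (simp add: one_less_power)
    then have "1 < min (1 / q\<^sup>2) ((j m)\<^sup>2 * (q\<^sup>2) ^ m)"
      using q2[OF q] by (simp add: power_mult_distrib power_mult[symmetric] mult.commute less_divide_eq)
    then obtain t where t: "1 < t" "t < 1 / q\<^sup>2" "t < (j m)\<^sup>2 * (q\<^sup>2) ^ m"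
      using dense[of 1 "min (1 / q\<^sup>2) ((j m)\<^sup>2 * (q\<^sup>2) ^ m)"] by auto
    have "q\<^sup>2 * t < 1" using t q by (simp add: field_simps)
    (* m zeros below (j m)^2 do not fit among the m - 1 squares of j 1, ..., j (m - 1) *)
    from has_zeros_card[OF he_fun_has_zeros[OF q a t(1) this, of m]]
    obtain A where A: "finite A" "card A = m"
      "A \<subseteq> {w. 0 < w \<and> w \<le> t / (q\<^sup>2) ^ m \<and> he_fun q a w = 0}" by blast
    have "sqrt ` A \<subseteq> j ` {1..<m}"
    proof
      fix z assume "z \<in> sqrt ` A"
      then obtain w where w: "w \<in> A" "z = sqrt w" by auto
      then have w': "0 < w" "w \<le> t / (q\<^sup>2) ^ m" "he_fun q a w = 0" using A by auto
      then have "z \<in> j ` {1..}" unfolding zeros using w by simp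
      then obtain n where n: "1 \<le> n" "z = j n" by auto
      have "t / (q\<^sup>2) ^ m < (j m)\<^sup>2"
        using t(3) q2_pow[OF q, of m] by (simp add: divide_less_eq)
      then have "(j n)\<^sup>2 < (j m)\<^sup>2" using w w' n by simp
      then have "j n < j m" using jm(1)[OF m] by (auto dest: power2_less_imp_less)
      then have "n < m"
        using strict_mono_on_less[OF assms(4), of n m] m n by simp
      then show "z \<in> j ` {1..<m}" using n by auto
    qed
    then have "card (sqrt ` A) \<le> card (j ` {1..<m})" by (intro card_mono) auto
    also have "\<dots> \<le> m - 1" using card_image_le[of "{1..<m}" j] by simp
    also have "card (sqrt ` A) = m"
      using A by (subst card_image) (auto intro: inj_onI)
    finally show False using m by simp
  qed
  (* the derivative of the prefactor multiplies a value that is zero *)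
  have deriv_eq: "deriv (hahn_exton_J \<nu> q) z = 2 * C * (z powr (\<nu> - 1) * (z\<^sup>2 * deriv (he_fun q a) (z\<^sup>2)))"
    if "0 < z" "he_fun q a (z\<^sup>2) = 0" for z
  proof (rule DERIV_imp_deriv)
    have d: "((\<lambda>z. he_fun q a (z\<^sup>2)) has_real_derivative deriv (he_fun q a) (z\<^sup>2) * (2 * z)) (at z)"
      by (rule DERIV_chain2[OF he_fun_has_deriv[OF q a0 a(2)]]) (auto intro!: derivative_eq_intros)
    have p: "((\<lambda>z. z powr \<nu> * C) has_real_derivative \<nu> * z powr (\<nu> - 1) * C) (at z)"
      using that by (intro DERIV_cmult_right has_real_derivative_powr)
    have "z powr \<nu> = z powr (\<nu> - 1) * z"
      using that by (simp add: powr_diff)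
    then show "(hahn_exton_J \<nu> q has_real_derivative
        2 * C * (z powr (\<nu> - 1) * (z\<^sup>2 * deriv (he_fun q a) (z\<^sup>2)))) (at z)"
      using DERIV_mult[OF p d] that unfolding J[abs_def]
      by (simp add: power2_eq_square mult_ac)
  qed
  define D where "D = 2 * (\<Sum>n. real n * q ^ n) * max 1 (1 / (j 1)\<^sup>2) * q powr (-4)
        / (qpoch_inf a (q\<^sup>2) * qpoch_inf (q\<^sup>2) (q\<^sup>2))"
  show ?thesis
  proof (rule bigoI[of _ "2 * C * D"])
    show "eventually (\<lambda>m. norm (deriv (hahn_exton_J \<nu> q) (j m))
        \<le> 2 * C * D * norm (q powr (- (real m * (real m + \<nu> - 2))))) at_top"
      using eventually_ge_at_top[of 1]
    proof eventually_elim
      case (elim m)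
      have "j 1 \<le> j m"
        using strict_mono_on_leD[OF assms(4), of 1 m] elim by simp
      from he_deriv_bound[OF q a0 a(2) assms(3) jm(1)[OF order_refl] this upper[OF elim] jm(2)[OF elim]]
      have "2 * C * (j m powr (\<nu> - 1) * \<bar>(j m)\<^sup>2 * deriv (he_fun q a) ((j m)\<^sup>2)\<bar>)
          \<le> 2 * C * (D * q powr (- (real m * (real m + \<nu> - 2))))"
        unfolding D_def using C by (intro mult_left_mono) auto
      then show ?case
        using deriv_eq[OF jm[OF elim]] C by (simp add: abs_mult mult_ac)
    qed
  qed
qed

end
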